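(* Let $k$ be a field and let $\Delta$ be a $(d-1)$-dimensional homology sphere (over $k$) on $n$ vertices with $n-d=2$. Then $\Delta$ is the join of the boundaries of two simplices. In particular, $\Delta$ is not unsuspended.
   Context: A simplicial complex $\Delta$ on $n$ vertices is a family of subsets (faces) of a vertex set identified with $[n]=\{1,\dots,n\}$, closed under taking subsets, containing $\emptyset$ and all singletons $\{i\}$, $i\in[n]$. A homology sphere (over $k$) is a $(d-1)$-dimensional simplicial complex, $d\ge 1$, such that for every face $F$ (including $F=\emptyset$) the link $\{S : S\cap F=\emptyset,\ S\cup F\in\Delta\}$ has the same reduced homology over $k$ as a sphere of dimension $d-1-|F|$. The join of complexes on disjoint vertex sets is $\Delta\ast\Gamma=\{S\cup T : S\in\Delta,\ T\in\Gamma\}$. For a vertex $v$, $lk_\Delta(v)=\{S\in\Delta : v\notin S,\ S\cup\{v\}\in\Delta\}$. The one-point suspension of $\Delta$ at $v$ is $\Sigma_{1,v}\Delta=\{S,\ S\cup\{v\},\ S\cup\{v'\} : v\notin S\in\Delta\}\cup\{S\cup\{v,v'\} : S\in lk_\Delta(v)\}$, where $v'$ is a new vertex. The two-point suspension is $\Sigma_2\Delta=\{S,\ S\cup\{w\},\ S\cup\{w'\} : S\in\Delta\}$, where $w,w'$ are two new vertices. A simplicial complex is unsuspended if it cannot be obtained from another complex by an iterated application of operations $\Sigma_{1,v}$ and $\Sigma_2$. *)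

theory Defs
  imports Main "HOL-Library.Function_Algebras" "HOL-Library.Set_Algebras"
begin

definition simplicial_complex :: "'a set \<Rightarrow> 'a set set \<Rightarrow> bool" where
  "simplicial_complex V \<Delta> \<longleftrightarrow>
     finite V \<and> \<Delta> \<subseteq> Pow V \<and> {} \<in> \<Delta> \<and> (\<forall>v\<in>V. {v} \<in> \<Delta>) \<and>
     (\<forall>S\<in>\<Delta>. \<forall>T. T \<subseteq> S \<longrightarrow> T \<in> \<Delta>)"

definition complex_dim :: "'a set set \<Rightarrow> int" where
  "complex_dim \<Delta> = int (Max (card ` \<Delta>)) - 1"

definition link :: "'a set set \<Rightarrow> 'a set \<Rightarrow> 'a set set" where
  "link \<Delta> F = {S. S \<inter> F = {} \<and> S \<union> F \<in> \<Delta>}"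

definition join :: "'a set set \<Rightarrow> 'a set set \<Rightarrow> 'a set set" where
  "join \<Delta> \<Gamma> = {S \<union> T | S T. S \<in> \<Delta> \<and> T \<in> \<Gamma>}"

definition simplex_boundary :: "'a set \<Rightarrow> 'a set set" where
  "simplex_boundary A = {S. S \<subset> A}"


text \<open>
  Reduced simplicial homology with coefficients in the field \<open>'k\<close>. The vertices are totally
  ordered, so a chain is a coefficient function on faces, each face being oriented by the order.
  Degrees are integers; the empty face spans the chains of degree \<open>-1\<close>.
\<close>

definition chains :: "'a set set \<Rightarrow> int \<Rightarrow> ('a set \<Rightarrow> 'k::field) set" where
  "chains \<Delta> i = {c. \<forall>S. c S \<noteq> 0 \<longrightarrow> S \<in> \<Delta> \<and> int (card S) = i + 1}"

text \<open>
  This is the linear extension of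
  \<open>[v\<^sub>0,\<dots>,v\<^sub>i] \<mapsto> \<Sum>j. (-1)^j [v\<^sub>0,\<dots>,v\<^sub>i without v\<^sub>j]\<close> for \<open>v\<^sub>0 < \<dots> < v\<^sub>i\<close>, written
  through its coefficient at each face \<open>F\<close>. A chain of \<open>\<Delta>\<close> vanishes on \<open>insert v F\<close> unless this
  is a face of \<open>\<Delta>\<close>, and the exponent is the position of \<open>v\<close> in that face.
\<close>

definition boundary_map ::
    "'a::linorder set set \<Rightarrow> ('a set \<Rightarrow> 'k::field) \<Rightarrow> ('a set \<Rightarrow> 'k)" where
  "boundary_map \<Delta> c = (\<lambda>F. \<Sum>v\<in>\<Union>\<Delta> - F. (-1) ^ card {u\<in>F. u < v} * c (insert v F))"

definition cycles :: "'a::linorder set set \<Rightarrow> int \<Rightarrow> ('a set \<Rightarrow> 'k::field) set" where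
  "cycles \<Delta> i = {c \<in> chains \<Delta> i. boundary_map \<Delta> c = 0}"

definition boundaries :: "'a::linorder set set \<Rightarrow> int \<Rightarrow> ('a set \<Rightarrow> 'k::field) set" where
  "boundaries \<Delta> i = boundary_map \<Delta> ` chains \<Delta> (i + 1)"

definition reduced_homology ::
    "'a::linorder set set \<Rightarrow> int \<Rightarrow> ('a set \<Rightarrow> 'k::field) set set" where
  "reduced_homology \<Delta> i = (\<lambda>z. z +o boundaries \<Delta> i) ` cycles \<Delta> i"

text \<open>
  Addition of homology classes is the elementwise sum of cosets. In the scalar multiple, adding
  the boundaries matters only for the scalar \<open>0\<close>.
\<close>

definition class_scale ::
    "'a::linorder set set \<Rightarrow> int \<Rightarrow> 'k::field \<Rightarrow> ('a set \<Rightarrow> 'k) set \<Rightarrow> ('a set \<Rightarrow> 'k) set" where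
  "class_scale \<Delta> i a X = (\<lambda>x S. a * x S) ` X + boundaries \<Delta> i"

text \<open>
  The reduced homology of the \<open>m\<close>-sphere over \<open>'k\<close> is \<open>'k\<close> in degree \<open>m\<close> and zero in all other
  degrees (for \<open>m = -1\<close> the sphere is empty). Isomorphism with \<open>'k\<close> is as vector spaces.
\<close>

definition has_sphere_homology ::
    "'k::field itself \<Rightarrow> int \<Rightarrow> 'a::linorder set set \<Rightarrow> bool" where
  "has_sphere_homology _ m \<Delta> \<longleftrightarrow>
     (\<exists>\<phi> :: 'k \<Rightarrow> ('a set \<Rightarrow> 'k) set.
        bij_betw \<phi> UNIV (reduced_homology \<Delta> m) \<and>
        (\<forall>a b. \<phi> (a + b) = \<phi> a + \<phi> b) \<and>
        (\<forall>a b. \<phi> (a * b) = class_scale \<Delta> m a (\<phi> b))) \<and>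
     (\<forall>i. i \<noteq> m \<longrightarrow>
        (reduced_homology \<Delta> i :: ('a set \<Rightarrow> 'k) set set) = {boundaries \<Delta> i})"

definition homology_sphere ::
    "'k::field itself \<Rightarrow> nat \<Rightarrow> 'a::linorder set \<Rightarrow> 'a set set \<Rightarrow> bool" where
  "homology_sphere K d V \<Delta> \<longleftrightarrow>
     simplicial_complex V \<Delta> \<and> 1 \<le> d \<and> complex_dim \<Delta> = int d - 1 \<and>
     (\<forall>F\<in>\<Delta>. has_sphere_homology K (int d - 1 - int (card F)) (link \<Delta> F))"


definition one_point_suspension :: "'a set set \<Rightarrow> 'a \<Rightarrow> 'a \<Rightarrow> 'a set set" where
  "one_point_suspension \<Delta> v v' =
     (\<Union>S\<in>{S\<in>\<Delta>. v \<notin> S}. {S, S \<union> {v}, S \<union> {v'}}) \<union> {S \<union> {v, v'} | S. S \<in> link \<Delta> {v}}"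

definition two_point_suspension :: "'a set set \<Rightarrow> 'a \<Rightarrow> 'a \<Rightarrow> 'a set set" where
  "two_point_suspension \<Delta> w w' = (\<Union>S\<in>\<Delta>. {S, S \<union> {w}, S \<union> {w'}})"

definition suspension_step :: "'a set set \<Rightarrow> 'a set set \<Rightarrow> bool" where
  "suspension_step \<Gamma> \<Delta> \<longleftrightarrow>
     (\<exists>v v'. v \<in> \<Union>\<Gamma> \<and> v' \<notin> \<Union>\<Gamma> \<and> \<Delta> = one_point_suspension \<Gamma> v v') \<or>
     (\<exists>w w'. w \<notin> \<Union>\<Gamma> \<and> w' \<notin> \<Union>\<Gamma> \<and> w \<noteq> w' \<and> \<Delta> = two_point_suspension \<Gamma> w w')"

text \<open>
  A suspension keeps the old vertex names, so every complex leading to \<open>\<Delta>\<close> (up to relabelling)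
  can be found on a subset of the vertices of \<open>\<Delta>\<close>, and equality may be used instead of
  isomorphism. At least one suspension is required.
\<close>

definition unsuspended :: "'a set set \<Rightarrow> bool" where
  "unsuspended \<Delta> \<longleftrightarrow> \<not> (\<exists>W \<Gamma>. simplicial_complex W \<Gamma> \<and> suspension_step\<^sup>+\<^sup>+ \<Gamma> \<Delta>)"

end

theory Submission
  imports Defs
begin

text \<open>
  Only the homology of links in their top degree matters. It shows that every face lies in a
  face with \<open>d\<close> vertices, and that the link of a face with \<open>d - 1\<close> vertices consists of exactly
  two points. Complements of facets are pairs, so they form a graph on \<open>V\<close>, and the condition
  on links says that three vertices span either no edge or exactly two edges. Such a graph is
  complete bipartite; its two parts are the vertex sets of the two simplices.
\<close>

section \<open>Top homology\<close>

lemma boundary_map_0: "boundary_map \<Delta> 0 = 0"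
  by (simp add: boundary_map_def fun_eq_iff)

text \<open>Without faces in degree \<open>m + 1\<close>, a class of degree \<open>m\<close> is a single cycle.\<close>

lemma sphere_homology_top_cycle:
  fixes L :: "'a::linorder set set"
  assumes sphere: "has_sphere_homology TYPE('k::field) m L"
    and top: "\<And>S. S \<in> L \<Longrightarrow> int (card S) \<le> m + 1"
  obtains z :: "'a set \<Rightarrow> 'k::field" where "z \<noteq> 0" "z \<in> cycles L m"
    "\<And>y. y \<in> cycles L m \<Longrightarrow> \<exists>a. y = (\<lambda>S. a * z S)"
proof -
  have "c = 0" if "c \<in> chains L (m + 1)" for c :: "'a set \<Rightarrow> 'k"
  proof
    fix S
    show "c S = 0 S"
      using that top[of S] by (force simp: chains_def)
  qed
  moreover have "0 \<in> (chains L (m + 1) :: ('a set \<Rightarrow> 'k) set)"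
    by (simp add: chains_def)
  ultimately have "chains L (m + 1) = {0 :: 'a set \<Rightarrow> 'k}"
    by blast
  then have bd: "boundaries L m = {0 :: 'a set \<Rightarrow> 'k}"
    by (simp add: boundaries_def boundary_map_0)
  have hom: "reduced_homology L m = (\<lambda>z :: 'a set \<Rightarrow> 'k. {z}) ` cycles L m"
    by (simp add: reduced_homology_def bd elt_set_plus_def)
  obtain \<phi> :: "'k \<Rightarrow> ('a set \<Rightarrow> 'k) set"
    where bij: "bij_betw \<phi> UNIV (reduced_homology L m)"
      and scale: "\<And>a b. \<phi> (a * b) = class_scale L m a (\<phi> b)"
    using sphere unfolding has_sphere_homology_def by blast
  have "\<phi> 1 \<in> reduced_homology L m"
    using bij by (auto simp: bij_betw_def)
  then obtain z where z: "z \<in> cycles L m" "\<phi> 1 = {z}"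
    unfolding hom by blast
  \<comment> \<open>Linearity with \<open>a = a * 1\<close> makes \<open>\<phi>\<close> determined
    by the cycle \<open>z\<close> representing \<open>\<phi> 1\<close>; the added boundaries are
    only 0. Injectivity then excludes \<open>z = 0\<close>, and surjectivity makes \<open>z\<close>
    span all cycles.\<close>
  have \<phi>: "\<phi> a = {\<lambda>S. a * z S}" for a
    using scale[of a 1] by (simp add: z class_scale_def bd)
  show thesis
  proof
    have "\<phi> 0 \<noteq> \<phi> 1"
      using bij by (metis bij_betw_def injD zero_neq_one)
    then show "z \<noteq> 0"
      by (auto simp: \<phi> fun_eq_iff)
    show "z \<in> cycles L m" by (fact z)
    fix y :: "'a set \<Rightarrow> 'k"
    assume "y \<in> cycles L m"
    then have "{y} \<in> range \<phi>"
      using bij unfolding hom bij_betw_def by blast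
    then show "\<exists>a. y = (\<lambda>S. a * z S)"
      by (auto simp: \<phi>)
  qed
qed

text \<open>A nonzero cycle of degree \<open>m\<close> is supported on faces with
  \<open>m + 1\<close> vertices, so at least one exists.\<close>

lemma sphere_homology_top_face:
  fixes L :: "'a::linorder set set"
  assumes "has_sphere_homology TYPE('k::field) m L"
    and "\<And>S. S \<in> L \<Longrightarrow> int (card S) \<le> m + 1"
  obtains S where "S \<in> L" "int (card S) = m + 1"
proof -
  obtain z :: "'a set \<Rightarrow> 'k" where z: "z \<noteq> 0" "z \<in> cycles L m"
    using sphere_homology_top_cycle[OF assms] by metis
  then obtain S where "z S \<noteq> 0"
    by (auto simp: fun_eq_iff)
  with z show thesis
    using that by (auto simp: cycles_def chains_def)
qed

text \<open>In degree 0 the boundary map is the augmentation: no vertex precedes \<open>v\<close> in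
  the empty face, so all signs are 1, and adding a new vertex to a nonempty \<open>F\<close> never
  gives a singleton.\<close>

lemma boundary_map_degree_0:
  fixes c :: "'a::linorder set \<Rightarrow> 'k::field"
  assumes "c \<in> chains L 0"
  shows "boundary_map L c = (\<lambda>F. if F = {} then \<Sum>v\<in>\<Union>L. c {v} else 0)"
proof
  fix F
  show "boundary_map L c F = (if F = {} then \<Sum>v\<in>\<Union>L. c {v} else 0)"
  proof (cases "F = {}")
    case False
    have "c (insert v F) = 0" if "v \<notin> F" for v
    proof (rule ccontr)
      assume "c (insert v F) \<noteq> 0"
      then have "card (insert v F) = 1"
        using assms by (auto simp: chains_def)
      then show False
        using that False by (auto simp: card_1_singleton_iff insert_eq_iff)
    qed
    then show ?thesis
      using False by (simp add: boundary_map_def)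
  qed (simp add: boundary_map_def)
qed

text \<open>On a discrete set of points the 0-cycles are the functions with coefficient sum 0. They
  form a space of dimension one less than the number of points, and this dimension has to be
  1.\<close>

lemma zero_sphere_two_vertices:
  fixes L :: "'a::linorder set set"
  assumes sphere: "has_sphere_homology TYPE('k::field) 0 L"
    and fin: "finite (\<Union>L)"
    and top: "\<And>S. S \<in> L \<Longrightarrow> card S \<le> 1"
  shows "card {v. {v} \<in> L} = 2"
proof -
  let ?W = "{v. {v} \<in> L}"
  have W: "\<Union>L = ?W"
  proof
    show "\<Union>L \<subseteq> ?W"
    proof
      fix v assume "v \<in> \<Union>L"
      then obtain S where S: "S \<in> L" "v \<in> S" by blast
      \<comment> \<open>Infinite sets have \<open>card\<close> 0, so the bound on
        \<open>card S\<close> alone would not make \<open>S\<close> a singleton.\<close>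
      then have "finite S"
        using fin by (meson Union_upper finite_subset)
      then have "S = {v}"
        using S top[of S] by (metis card_le_Suc0_iff_eq One_nat_def singletonI subsetI
            subset_singletonD insert_absorb insert_not_empty singleton_iff)
      then show "v \<in> ?W" using S by simp
    qed
  qed blast
  have finW: "finite ?W"
    using fin W by simp
  obtain z :: "'a set \<Rightarrow> 'k" where z: "z \<noteq> 0" "z \<in> cycles L 0"
    and span: "\<And>y. y \<in> cycles L 0 \<Longrightarrow> \<exists>a. y = (\<lambda>S. a * z S)"
  proof (rule sphere_homology_top_cycle[OF sphere])
    show "int (card S) \<le> 0 + 1" if "S \<in> L" for S
      using top[OF that] by simp
  qed blast
  have chain: "z \<in> chains L 0" and "boundary_map L z {} = 0"
    using z by (simp_all add: cycles_def)
  then have sum0: "(\<Sum>v\<in>?W. z {v}) = 0"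
    by (simp add: boundary_map_degree_0 W)
  obtain S where S: "z S \<noteq> 0"
    using z by (auto simp: fun_eq_iff)
  then obtain x where x: "S = {x}" "x \<in> ?W"
    using chain by (auto simp: chains_def card_1_singleton_iff)
  \<comment> \<open>If \<open>x\<close> were the only vertex, the vanishing sum would be its nonzero
    coefficient.\<close>
  have "\<exists>y\<in>?W. y \<noteq> x"
  proof (rule ccontr)
    assume "\<not> ?thesis"
    then have "?W = {x}" using x by blast
    then show False using sum0 S x by simp
  qed
  then obtain y where y: "y \<in> ?W" "y \<noteq> x" by blast
  have diff: "\<exists>a. (\<lambda>S. of_bool (S = {x}) - of_bool (S = {t})) = (\<lambda>S. a * z S)"
    if t: "t \<in> ?W" for t
  proof (rule span)
    let ?c = "\<lambda>S. of_bool (S = {x}) - of_bool (S = {t}) :: 'k"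
    have c: "?c \<in> chains L 0"
      using x t by (auto simp: chains_def)
    have "(\<Sum>v\<in>?W. ?c {v}) = 0"
      using x t finW by (simp add: sum_subtractf of_bool_def)
    then show "?c \<in> cycles L 0"
      using c by (simp add: cycles_def boundary_map_degree_0[OF c] W fun_eq_iff)
  qed
  \<comment> \<open>With a third vertex \<open>t\<close>, both \<open>x - y\<close> and
    \<open>x - t\<close> are multiples of \<open>z\<close>. The first forces
    \<open>z {t} = 0\<close>, the second forbids it.\<close>
  have "t \<in> {x, y}" if t: "t \<in> ?W" for t
  proof (rule ccontr)
    assume ne: "t \<notin> {x, y}"
    obtain a where a: "(\<lambda>S. of_bool (S = {x}) - of_bool (S = {y})) = (\<lambda>S. a * z S)"
      using diff[OF y(1)] by blast
    obtain b where b: "(\<lambda>S. of_bool (S = {x}) - of_bool (S = {t})) = (\<lambda>S. b * z S)"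
      using diff[OF t] by blast
    have "a * z {x} = 1" "a * z {t} = 0" "b * z {t} = -1"
      using fun_cong[OF a, of "{x}"] fun_cong[OF a, of "{t}"] fun_cong[OF b, of "{t}"] ne y
      by auto
    then show False by auto
  qed
  then have "?W = {x, y}"
    using x y by blast
  then show ?thesis
    using y by simp
qed

section \<open>Facets and ridges of homology spheres\<close>

lemma homology_sphere_face_card_le:
  assumes "homology_sphere K d V \<Delta>" "S \<in> \<Delta>"
  shows "card S \<le> d"
proof -
  have "finite \<Delta>" "Max (card ` \<Delta>) = d"
    using assms finite_subset
    by (fastforce simp: homology_sphere_def simplicial_complex_def complex_dim_def)+
  then show ?thesis
    using assms(2) by (metis Max_ge finite_imageI imageI)
qed

lemma homology_sphere_link_card_le:
  assumes "homology_sphere K d V \<Delta>" "F \<in> \<Delta>" "S \<in> link \<Delta> F"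
  shows "card S + card F \<le> d"
proof -
  have "S \<union> F \<in> \<Delta>" "S \<inter> F = {}"
    using assms by (auto simp: link_def)
  moreover have "finite (S \<union> F)"
    using assms(1) \<open>S \<union> F \<in> \<Delta>\<close> unfolding homology_sphere_def simplicial_complex_def
    by (meson PowD finite_subset subsetD)
  ultimately show ?thesis
    using homology_sphere_face_card_le[OF assms(1)] by (metis card_Un_disjoint finite_Un)
qed

text \<open>The link of \<open>F\<close> has nonzero homology in its top possible degree, hence a
  face with \<open>d - card F\<close> vertices, which completes \<open>F\<close> to a facet.\<close>

lemma homology_sphere_pure:
  assumes sphere: "homology_sphere TYPE('k::field) d V \<Delta>" and F: "F \<in> \<Delta>"
  obtains S where "S \<in> \<Delta>" "F \<subseteq> S" "card S = d"
proof -
  let ?m = "int d - 1 - int (card F)"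
  have "has_sphere_homology TYPE('k) ?m (link \<Delta> F)"
    using sphere F by (simp add: homology_sphere_def)
  moreover have "int (card S) \<le> ?m + 1" if "S \<in> link \<Delta> F" for S
    using homology_sphere_link_card_le[OF sphere F that] by linarith
  ultimately obtain S where S: "S \<in> link \<Delta> F" "int (card S) = ?m + 1"
    using sphere_homology_top_face by blast
  then have US: "S \<union> F \<in> \<Delta>" "S \<inter> F = {}"
    by (auto simp: link_def)
  have "finite (S \<union> F)"
    using sphere US unfolding homology_sphere_def simplicial_complex_def
    by (meson PowD finite_subset subsetD)
  then have "card (S \<union> F) = d"
    using US S by (simp add: card_Un_disjoint)
  then show thesis
    using that US by blast
qed

text \<open>The pseudomanifold property: the link of a ridge has the homology of a 0-sphere and
  consists of points, so there are two of them.\<close>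

lemma homology_sphere_ridge:
  assumes sphere: "homology_sphere TYPE('k::field) d V \<Delta>"
    and F: "F \<in> \<Delta>" "card F = d - 1"
  shows "card {v \<in> V - F. insert v F \<in> \<Delta>} = 2"
proof -
  have sc: "finite V" "\<Delta> \<subseteq> Pow V" and d: "1 \<le> d"
    using sphere by (auto simp: homology_sphere_def simplicial_complex_def)
  have "has_sphere_homology TYPE('k) (int d - 1 - int (card F)) (link \<Delta> F)"
    using sphere F(1) unfolding homology_sphere_def by blast
  moreover have "int d - 1 - int (card F) = 0"
    using F d by simp
  ultimately have "has_sphere_homology TYPE('k) 0 (link \<Delta> F)"
    by simp
  moreover have "\<Union>(link \<Delta> F) \<subseteq> V"
    using sc by (auto simp: link_def)
  then have "finite (\<Union>(link \<Delta> F))"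
    using sc finite_subset by blast
  moreover have "card S \<le> 1" if "S \<in> link \<Delta> F" for S
    using homology_sphere_link_card_le[OF sphere F(1) that] F d by linarith
  ultimately have "card {v. {v} \<in> link \<Delta> F} = 2"
    by (rule zero_sphere_two_vertices)
  moreover have "{v. {v} \<in> link \<Delta> F} = {v \<in> V - F. insert v F \<in> \<Delta>}"
    using sc by (auto simp: link_def)
  ultimately show ?thesis
    by simp
qed

section \<open>Joins of simplex boundaries\<close>

text \<open>Describes the join by its forbidden subsets \<open>A\<close> and \<open>B\<close>; the
  decomposition of a face is into its traces on \<open>A\<close> and \<open>B\<close>.\<close>

lemma mem_join_simplex_boundary_iff:
  assumes "A \<inter> B = {}"
  shows "S \<in> join (simplex_boundary A) (simplex_boundary B) \<longleftrightarrow>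
    S \<subseteq> A \<union> B \<and> \<not> A \<subseteq> S \<and> \<not> B \<subseteq> S"
proof
  assume "S \<in> join (simplex_boundary A) (simplex_boundary B)"
  then show "S \<subseteq> A \<union> B \<and> \<not> A \<subseteq> S \<and> \<not> B \<subseteq> S"
    using assms unfolding join_def simplex_boundary_def by blast
next
  assume "S \<subseteq> A \<union> B \<and> \<not> A \<subseteq> S \<and> \<not> B \<subseteq> S"
  then have "S = (S \<inter> A) \<union> (S \<inter> B)" "S \<inter> A \<subset> A" "S \<inter> B \<subset> B"
    by auto
  then show "S \<in> join (simplex_boundary A) (simplex_boundary B)"
    unfolding join_def simplex_boundary_def by blast
qed

text \<open>The size bounds make every singleton a face: a part consisting of one point would itself
  be a forbidden subset.\<close>

lemma simplicial_complex_join_simplex_boundary: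
  assumes "finite A" "finite B" "A \<inter> B = {}" "2 \<le> card A" "2 \<le> card B"
  shows "simplicial_complex (A \<union> B) (join (simplex_boundary A) (simplex_boundary B))"
proof -
  have "\<not> A \<subseteq> {v}" "\<not> B \<subseteq> {v}" for v
    using assms card_mono[of "{v}" A] card_mono[of "{v}" B] by auto
  then show ?thesis
    using assms(1,2) unfolding simplicial_complex_def
    by (auto simp only: mem_join_simplex_boundary_iff[OF assms(3)] finite_Un) blast+
qed

text \<open>The boundary of an edge is a pair of points, and joining with two points is
  suspension.\<close>

lemma join_simplex_boundary_two_point_suspension:
  assumes "w \<noteq> w'" "w \<notin> B" "w' \<notin> B"
  shows "join (simplex_boundary {w, w'}) (simplex_boundary B) =
    two_point_suspension (simplex_boundary B) w w'"
proof -
  have "simplex_boundary {w, w'} = {{}, {w}, {w'}}"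
    using assms by (auto simp: simplex_boundary_def)
  then show ?thesis
    by (auto simp: join_def two_point_suspension_def)
qed

text \<open>One-point suspension at \<open>v\<close> adds \<open>v'\<close> to the forbidden subset
  containing \<open>v\<close>, here \<open>A\<close>, and leaves \<open>B\<close> as it is.\<close>

lemma join_simplex_boundary_one_point_suspension:
  assumes AB: "A \<inter> B = {}" and v: "v \<in> A" "v' \<notin> A" "v' \<notin> B"
  shows "join (simplex_boundary (insert v' A)) (simplex_boundary B) =
    one_point_suspension (join (simplex_boundary A) (simplex_boundary B)) v v'"
    (is "?J = one_point_suspension ?\<Gamma> v v'")
proof (rule set_eqI)
  fix S
  have J: "T \<in> ?J \<longleftrightarrow> T \<subseteq> insert v' (A \<union> B) \<and> \<not> insert v' A \<subseteq> T \<and> \<not> B \<subseteq> T" for T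
    using AB v mem_join_simplex_boundary_iff[of "insert v' A" B T] by auto
  have G: "T \<in> ?\<Gamma> \<longleftrightarrow> T \<subseteq> A \<union> B \<and> \<not> A \<subseteq> T \<and> \<not> B \<subseteq> T" for T
    by (rule mem_join_simplex_boundary_iff[OF AB])
  have vv: "v \<noteq> v'" "v \<notin> B"
    using AB v by auto
  show "S \<in> ?J \<longleftrightarrow> S \<in> one_point_suspension ?\<Gamma> v v'"
  proof
    assume S: "S \<in> ?J"
    \<comment> \<open>This is the face of the smaller complex from which \<open>S\<close> arises;
      which of \<open>v\<close>, \<open>v'\<close> lie in \<open>S\<close> selects the clause of the
      suspension.\<close>
    let ?S = "S - {v, v'}"
    have sub: "?S \<subseteq> A \<union> B" "\<not> A \<subseteq> ?S" "\<not> B \<subseteq> ?S"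
      using S v unfolding J by auto
    then have "?S \<in> ?\<Gamma>" "v \<notin> ?S"
      unfolding G by auto
    moreover have "?S \<in> link ?\<Gamma> {v}" if "v \<in> S" "v' \<in> S"
      using S that AB v vv unfolding link_def G J by auto
    moreover have "S = ?S \<or> S = ?S \<union> {v} \<or> S = ?S \<union> {v'} \<or>
        v \<in> S \<and> v' \<in> S \<and> S = ?S \<union> {v, v'}"
      by auto
    ultimately show "S \<in> one_point_suspension ?\<Gamma> v v'"
      unfolding one_point_suspension_def by blast
  next
    assume "S \<in> one_point_suspension ?\<Gamma> v v'"
    then consider T where "T \<in> ?\<Gamma>" "v \<notin> T" "S = T \<or> S = T \<union> {v} \<or> S = T \<union> {v'}"
      | T where "T \<in> link ?\<Gamma> {v}" "S = T \<union> {v, v'}"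
      unfolding one_point_suspension_def by blast
    then show "S \<in> ?J"
    proof cases
      case 1
      then show ?thesis
        using v vv unfolding G J by blast
    next
      case 2
      then have "T \<union> {v} \<in> ?\<Gamma>" "v \<notin> T"
        by (auto simp: link_def)
      then show ?thesis
        using 2 v vv unfolding G J by blast
    qed
  qed
qed

text \<open>One suspension step suffices. Removing a vertex of \<open>A\<close> undoes a one-point
  suspension if at least two vertices remain; a two-element \<open>A\<close> instead comes from a
  two-point suspension.\<close>

lemma not_unsuspended_join_simplex_boundary:
  assumes fin: "finite A" "finite B" and AB: "A \<inter> B = {}"
    and card: "2 \<le> card A" "2 \<le> card B"
  shows "\<not> unsuspended (join (simplex_boundary A) (simplex_boundary B))"
proof (cases "card A = 2")
  case True
  then obtain w w' where w: "A = {w, w'}" "w \<noteq> w'"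
    by (meson card_2_iff)
  have "\<not> B \<subseteq> {v}" for v
    using fin card card_mono[of "{v}" B] by auto
  then have "simplicial_complex B (simplex_boundary B)"
    using fin by (auto simp: simplicial_complex_def simplex_boundary_def)
  moreover have "w \<notin> \<Union>(simplex_boundary B)" "w' \<notin> \<Union>(simplex_boundary B)"
    using AB w by (auto simp: simplex_boundary_def)
  then have "suspension_step (simplex_boundary B)
      (join (simplex_boundary A) (simplex_boundary B))"
    using join_simplex_boundary_two_point_suspension[of w w' B] AB w
    unfolding suspension_step_def by blast
  ultimately show ?thesis
    unfolding unsuspended_def by blast
next
  case False
  obtain v' where v': "v' \<in> A"
    using card by fastforce
  define A' where "A' = A - {v'}"
  \<comment> \<open>Here \<open>A\<close> has at least three elements, so \<open>A'\<close> keeps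
    two and the smaller join is again a complex on all its vertices.\<close>
  have A': "A = insert v' A'" "v' \<notin> A'" "finite A'" "A' \<inter> B = {}" "2 \<le> card A'"
    using v' fin AB card False by (auto simp: A'_def)
  then obtain v where v: "v \<in> A'"
    by fastforce
  let ?\<Gamma> = "join (simplex_boundary A') (simplex_boundary B)"
  have sc: "simplicial_complex (A' \<union> B) ?\<Gamma>"
    using A' fin card by (intro simplicial_complex_join_simplex_boundary)
  then have "{v} \<in> ?\<Gamma>" and faces: "?\<Gamma> \<subseteq> Pow (A' \<union> B)"
    using v by (auto simp: simplicial_complex_def)
  then have "v \<in> \<Union>?\<Gamma>"
    by blast
  moreover have "v' \<notin> B"
    using v' AB by blast
  moreover have "v' \<notin> \<Union>?\<Gamma>"
    using faces A'(2) \<open>v' \<notin> B\<close> by blast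
  ultimately have "suspension_step ?\<Gamma> (join (simplex_boundary A) (simplex_boundary B))"
    using join_simplex_boundary_one_point_suspension[of A' B v v'] A' v
    unfolding suspension_step_def by blast
  then show ?thesis
    using sc unfolding unsuspended_def by blast
qed

section \<open>Homology spheres with two more vertices than their facets\<close>

text \<open>The graph argument: fix one edge \<open>a b\<close>; the neighbours of \<open>b\<close>
  and those of \<open>a\<close> are the two parts.\<close>

lemma homology_sphere_two_extra_vertices:
  assumes sphere: "homology_sphere TYPE('k::field) d V \<Delta>" and card: "card V = d + 2"
  obtains A B where "A \<inter> B = {}" "A \<union> B = V" "2 \<le> card A" "2 \<le> card B"
    "\<Delta> = join (simplex_boundary A) (simplex_boundary B)"
proof -
  have fin: "finite V" and sub: "\<And>S. S \<in> \<Delta> \<Longrightarrow> S \<subseteq> V" and empty: "{} \<in> \<Delta>"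
    and vert: "\<And>v. v \<in> V \<Longrightarrow> {v} \<in> \<Delta>"
    and down: "\<And>S T. S \<in> \<Delta> \<Longrightarrow> T \<subseteq> S \<Longrightarrow> T \<in> \<Delta>"
    using sphere by (auto simp: homology_sphere_def simplicial_complex_def)
  have d: "1 \<le> d"
    using sphere by (simp add: homology_sphere_def)
  define E where "E x y \<longleftrightarrow> x \<in> V \<and> y \<in> V \<and> x \<noteq> y \<and> V - {x, y} \<in> \<Delta>" for x y
  have E_sym: "E y x" if "E x y" for x y
    using that unfolding E_def by (auto simp: insert_commute)
  \<comment> \<open>The facets containing the ridge \<open>F\<close> arise by adding one of
    \<open>x\<close>, \<open>y\<close>, \<open>t\<close>, and are the complements of the other two.
    Exactly two of the three pairs are therefore edges, and \<open>x y\<close> is one of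
    them.\<close>
  have triple: "E x t \<longleftrightarrow> \<not> E y t" if xy: "E x y" and t: "t \<in> V" "t \<noteq> x" "t \<noteq> y" for x y t
  proof -
    define F where "F = V - {x, y, t}"
    have V: "x \<in> V" "y \<in> V" "x \<noteq> y" and facet: "V - {x, y} \<in> \<Delta>"
      using xy by (auto simp: E_def)
    have "F \<subseteq> V - {x, y}"
      by (auto simp: F_def)
    then have F: "F \<in> \<Delta>"
      by (rule down[OF facet])
    have "card {x, y, t} = 3"
      using V t by auto
    then have "card F = d - 1"
      unfolding F_def using card fin V t d by (simp add: card_Diff_subset)
    then have two: "card {v \<in> V - F. insert v F \<in> \<Delta>} = 2"
      by (rule homology_sphere_ridge[OF sphere F])
    have F_insert: "insert x F = V - {y, t}" "insert y F = V - {x, t}" "insert t F = V - {x, y}"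
      unfolding F_def using V t by auto
    have "V - F = {x, y, t}"
      unfolding F_def using V t by auto
    moreover have "insert x F \<in> \<Delta> \<longleftrightarrow> E y t" "insert y F \<in> \<Delta> \<longleftrightarrow> E x t" "insert t F \<in> \<Delta>"
      using V t facet unfolding F_insert E_def by simp_all
    ultimately have "{v \<in> V - F. insert v F \<in> \<Delta>} =
        insert t ((if E y t then {x} else {}) \<union> (if E x t then {y} else {}))"
      by auto
    with two V t show ?thesis
      by (cases "E x t"; cases "E y t") auto
  qed
  \<comment> \<open>Purity puts \<open>S\<close> into a facet, whose complement in \<open>V\<close>
    is an edge.\<close>
  have face: "\<exists>x y. E x y \<and> x \<notin> S \<and> y \<notin> S" if S: "S \<in> \<Delta>" for S
  proof -
    obtain T where T: "T \<in> \<Delta>" "S \<subseteq> T" "card T = d"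
      using homology_sphere_pure[OF sphere S] by blast
    have TV: "T \<subseteq> V" using sub T by blast
    then have "card (V - T) = 2"
      using T card fin by (simp add: card_Diff_subset finite_subset)
    then obtain x y where xy: "V - T = {x, y}" "x \<noteq> y"
      by (meson card_2_iff)
    then have "V - {x, y} = T" using TV by blast
    then have "E x y" using xy T by (auto simp: E_def)
    then show ?thesis using xy T by blast
  qed
  obtain a b where ab: "E a b"
    using face[OF empty] by blast
  define A where "A = {x \<in> V. E x b}"
  define B where "B = {x \<in> V. E x a}"
  have irrefl: "\<not> E x x" for x
    by (simp add: E_def)
  have in_V: "a \<in> V" "b \<in> V" "a \<noteq> b"
    using ab by (auto simp: E_def)
  have parts: "x \<in> A \<longleftrightarrow> x \<notin> B" if "x \<in> V" for x
  proof -
    have "E x b \<longleftrightarrow> \<not> E x a"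
    proof (cases "x = a \<or> x = b")
      case True
      then show ?thesis
        using ab E_sym[OF ab] irrefl by blast
    next
      case False
      then have "E a x \<longleftrightarrow> \<not> E b x"
        using triple[OF ab that] by blast
      then show ?thesis
        using E_sym by blast
    qed
    then show ?thesis
      using that by (simp add: A_def B_def)
  qed
  then have disj: "A \<inter> B = {}" and un: "A \<union> B = V"
    by (auto simp: A_def B_def)
  \<comment> \<open>Both vertices are joined to \<open>b\<close>, and a triangle would contradict
    \<open>triple\<close>.\<close>
  have sameA: "\<not> E x y" if "x \<in> A" "y \<in> A" for x y
  proof -
    have "E x b" "E b y" "y \<in> V" "y \<noteq> b"
      using that E_sym irrefl by (auto simp: A_def)
    then show ?thesis
      using triple[of x b y] irrefl by blast
  qed
  have sameB: "\<not> E x y" if "x \<in> B" "y \<in> B" for x y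
  proof -
    have "E x a" "E a y" "y \<in> V" "y \<noteq> a"
      using that E_sym irrefl by (auto simp: B_def)
    then show ?thesis
      using triple[of x a y] irrefl by blast
  qed
  \<comment> \<open>For \<open>y\<close> other than \<open>b\<close>, the edge \<open>x b\<close>
    must be met by exactly one edge from \<open>y\<close>; since \<open>y\<close> is not joined to
    \<open>b\<close>, that edge goes to \<open>x\<close>.\<close>
  have cross: "E x y" if xy: "x \<in> A" "y \<in> B" for x y
  proof (cases "y = b")
    case False
    have "E x b" "y \<in> V" "y \<noteq> x" "\<not> E y b"
      using xy disj by (auto simp: A_def B_def)
    then show ?thesis
      using triple[of x b y] False E_sym by blast
  qed (use xy in \<open>simp add: A_def\<close>)
  have eq: "\<Delta> = join (simplex_boundary A) (simplex_boundary B)"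
  proof (rule set_eqI)
    fix S
    have "S \<in> \<Delta> \<longleftrightarrow> S \<subseteq> V \<and> (\<exists>x\<in>A. x \<notin> S) \<and> (\<exists>y\<in>B. y \<notin> S)"
    proof
      assume S: "S \<in> \<Delta>"
      obtain x y where xy: "E x y" "x \<notin> S" "y \<notin> S"
        using face[OF S] by blast
      then have "x \<in> V" "y \<in> V" by (auto simp: E_def)
      then have "x \<in> A \<and> y \<in> B \<or> x \<in> B \<and> y \<in> A"
        using xy sameA sameB parts by blast
      then show "S \<subseteq> V \<and> (\<exists>x\<in>A. x \<notin> S) \<and> (\<exists>y\<in>B. y \<notin> S)"
        using sub[OF S] xy by blast
    next
      assume S: "S \<subseteq> V \<and> (\<exists>x\<in>A. x \<notin> S) \<and> (\<exists>y\<in>B. y \<notin> S)"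
      then obtain x y where "x \<in> A" "y \<in> B" "x \<notin> S" "y \<notin> S" by blast
      then have "V - {x, y} \<in> \<Delta>" "S \<subseteq> V - {x, y}"
        using S cross by (auto simp: E_def)
      then show "S \<in> \<Delta>" by (rule down)
    qed
    then show "S \<in> \<Delta> \<longleftrightarrow> S \<in> join (simplex_boundary A) (simplex_boundary B)"
      unfolding mem_join_simplex_boundary_iff[OF disj] un by blast
  qed
  \<comment> \<open>The parts contain \<open>a\<close> and \<open>b\<close> respectively. A part
    \<open>{v}\<close> would be a non-face, although all singletons are faces.\<close>
  have large: "2 \<le> card C" if C: "C = A \<or> C = B" for C
  proof -
    obtain v where v: "v \<in> C"
      using C ab E_sym[OF ab] in_V unfolding A_def B_def by blast
    then have "{v} \<in> join (simplex_boundary A) (simplex_boundary B)"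
      using vert C un eq by blast
    then have "\<not> C \<subseteq> {v}"
      using C unfolding mem_join_simplex_boundary_iff[OF disj] by blast
    then obtain w where "w \<in> C" "w \<noteq> v" by blast
    moreover have "finite C"
      using C fin un by auto
    ultimately show ?thesis
      using v card_mono[of C "{v, w}"] by auto
  qed
  show thesis
    using that[OF disj un _ _ eq] large by blast
qed

theorem proposition5p1:
  fixes V :: "'a::linorder set" and \<Delta> :: "'a set set" and d n :: nat
  assumes "homology_sphere TYPE('k::field) d V \<Delta>"
    and "card V = n"
    and "int n - int d = 2"
  shows "(\<exists>A B. A \<inter> B = {} \<and> A \<union> B = V \<and> 2 \<le> card A \<and> 2 \<le> card B \<and>
            \<Delta> = join (simplex_boundary A) (simplex_boundary B))
         \<and> \<not> unsuspended \<Delta>"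
proof -
  have "card V = d + 2"
    using assms by linarith
  then obtain A B where AB: "A \<inter> B = {}" "A \<union> B = V" "2 \<le> card A" "2 \<le> card B"
    "\<Delta> = join (simplex_boundary A) (simplex_boundary B)"
    using homology_sphere_two_extra_vertices[OF assms(1)] by blast
  \<comment> \<open>Infinite sets have \<open>card\<close> 0, so the size bounds give
    finiteness.\<close>
  have "finite A" "finite B"
    using AB(3,4) by (auto intro: card_ge_0_finite)
  then have "\<not> unsuspended \<Delta>"
    using not_unsuspended_join_simplex_boundary AB by blast
  then show ?thesis
    using AB by blast
qed

end
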